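(* $\mathrm{Rs}(P_3\cup K_1)=\mathrm{Rs}(K_2\cup 2K_1)=10$.
   Context: All graphs are finite and simple. $P_3\cup K_1$ is the path on three vertices plus one isolated vertex; $K_2\cup 2K_1$ is an edge plus two isolated vertices. A (not necessarily induced) subgraph $H$ of a host graph $F$ is singular if the degrees $d_F(v)$, $v\in V(H)$, taken in $F$, are all equal or pairwise distinct (isolated vertices of $H$ count as vertices). In an edge 2-coloring of $K_m$, the host graph of a color is the spanning graph on all $m$ vertices formed by the edges of that color. The singular Ramsey number $\mathrm{Rs}(G)$ is the smallest integer $N$ such that for every $m\ge N$ and every 2-coloring of the edges of $K_m$, at least one of the two color graphs contains a singular subgraph isomorphic to $G$. *)

theory Defs
  imports "HOL-Library.Ramsey" "HOL-Library.Extended_Nat"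
begin

text \<open>A graph is a pair of a vertex set and a set of edges, edges being two-element sets of vertices.\<close>

type_synonym 'a graph = "'a set \<times> 'a set set"

abbreviation verts :: "'a graph \<Rightarrow> 'a set" where "verts \<equiv> fst"

abbreviation edges :: "'a graph \<Rightarrow> 'a set set" where "edges \<equiv> snd"

definition simple_graph :: "'a graph \<Rightarrow> bool" where
  "simple_graph F \<longleftrightarrow> finite (verts F) \<and> edges F \<subseteq> [verts F]\<^bsup>2\<^esup>"

definition subgraph :: "'a graph \<Rightarrow> 'a graph \<Rightarrow> bool" where
  "subgraph H F \<longleftrightarrow> simple_graph H \<and> simple_graph F \<and> verts H \<subseteq> verts F \<and> edges H \<subseteq> edges F"

definition graph_iso :: "'a graph \<Rightarrow> 'b graph \<Rightarrow> bool" where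
  "graph_iso G H \<longleftrightarrow> (\<exists>f. bij_betw f (verts G) (verts H) \<and>
     (\<forall>u\<in>verts G. \<forall>v\<in>verts G. {u, v} \<in> edges G \<longleftrightarrow> {f u, f v} \<in> edges H))"

definition degree :: "'a graph \<Rightarrow> 'a \<Rightarrow> nat" where
  "degree F v = card {e \<in> edges F. v \<in> e}"

definition singular_subgraph :: "'a graph \<Rightarrow> 'a graph \<Rightarrow> bool" where
  "singular_subgraph H F \<longleftrightarrow> subgraph H F \<and>
     ((\<forall>u\<in>verts H. \<forall>v\<in>verts H. degree F u = degree F v) \<or>
      (\<forall>u\<in>verts H. \<forall>v\<in>verts H. u \<noteq> v \<longrightarrow> degree F u \<noteq> degree F v))"

definition complete_graph :: "nat \<Rightarrow> nat graph" where
  "complete_graph m = ({..<m}, [{..<m}]\<^bsup>2\<^esup>)"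

text \<open>A 2-coloring is a map from edges to \<^typ>\<open>bool\<close>; its values outside the edges of
  \<^term>\<open>complete_graph m\<close> are irrelevant.\<close>

definition host_graph :: "nat \<Rightarrow> (nat set \<Rightarrow> bool) \<Rightarrow> bool \<Rightarrow> nat graph" where
  "host_graph m c b = (verts (complete_graph m), {e \<in> edges (complete_graph m). c e = b})"

definition singular_unavoidable :: "'a graph \<Rightarrow> nat \<Rightarrow> bool" where
  "singular_unavoidable G m \<longleftrightarrow>
     (\<forall>c. \<exists>b H. singular_subgraph H (host_graph m c b) \<and> graph_iso G H)"

text \<open>The infimum over the empty set is \<^term>\<open>\<infinity> :: enat\<close>, so a finite value
  of the function below is attained, i.e. it is the minimum.\<close>

definition Rs :: "'a graph \<Rightarrow> enat" where
  "Rs G = Inf {enat N | N. \<forall>m\<ge>N. singular_unavoidable G m}"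

definition P3_K1 :: "nat graph" where
  "P3_K1 = ({0, 1, 2, 3}, {{0, 1}, {1, 2}})"

definition K2_2K1 :: "nat graph" where
  "K2_2K1 = ({0, 1, 2, 3}, {{0, 1}})"

end

theory Submission
  imports Defs
begin

text \<open>
  In a 2-coloring of \<^term>\<open>complete_graph m\<close> the two degrees of a vertex add up to
  \<^term>\<open>m - 1\<close>. So whether the degrees are constant, or pairwise distinct, on a set of vertices
  does not depend on the color in which they are taken. Moreover every 2-coloring of the edges of
  a complete graph on four vertices has a monochromatic \<open>P\<^sub>3\<close>, because two of the three edges at
  any vertex share a color; together with the fourth vertex it spans \<open>P\<^sub>3 \<union> K\<^sub>1\<close>, which contains
  \<open>K\<^sub>2 \<union> 2K\<^sub>1\<close>. Hence for both graphs a coloring avoids singular copies if and only if no four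
  vertices have equal or pairwise distinct degrees, that is, if and only if at most three degrees
  occur, each at most three times.

  This forces at most nine vertices (\<open>constant_or_injective_subset\<close>), so every larger complete
  graph is unavoidable. On nine vertices the extreme case is realized: in the graph consisting of
  a triangle joined completely to three independent vertices, plus three isolated vertices, the
  degrees \<open>5\<close>, \<open>3\<close> and \<open>0\<close> occur three times each.
\<close>

section \<open>Constant or injective restrictions\<close>

text \<open>Pigeonhole principle: at most \<^term>\<open>k\<close> values taken at most \<^term>\<open>k\<close> times each account for
  only \<^term>\<open>k * k\<close> elements.\<close>

lemma constant_or_injective_subset:
  fixes f :: "'a \<Rightarrow> 'b"
  assumes fin: "finite V" and large: "k * k < card V"
  obtains S where "S \<subseteq> V" "card S = Suc k"
    "(\<forall>u\<in>S. \<forall>v\<in>S. f u = f v) \<or> inj_on f S"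
proof (cases "k < card (f ` V)")
  case True
  then obtain T where T: "T \<subseteq> f ` V" "card T = Suc k"
    by (meson Suc_leI obtain_subset_with_card_n)
  then obtain S where "S \<subseteq> V" "inj_on f S" "T = f ` S"
    by (meson subset_image_inj)
  then show ?thesis
    using T that by (simp add: card_image)
next
  case False
  have "\<exists>y\<in>f ` V. k < card {v \<in> V. f v = y}"
  proof (rule ccontr)
    assume "\<not> ?thesis"
    then have small: "card {v \<in> V. f v = y} \<le> k" if "y \<in> f ` V" for y
      using that by force
    have "card V = card (\<Union>y\<in>f ` V. {v \<in> V. f v = y})"
      by (rule arg_cong[where f = card]) auto
    also have "\<dots> \<le> (\<Sum>y\<in>f ` V. card {v \<in> V. f v = y})"
      by (rule card_UN_le) (simp add: fin)
    also have "\<dots> \<le> card (f ` V) * k"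
      using sum_bounded_above[of "f ` V" "\<lambda>y. card {v \<in> V. f v = y}" k] small by simp
    also have "\<dots> \<le> k * k"
      using False by simp
    finally show False
      using large by simp
  qed
  then obtain y where "Suc k \<le> card {v \<in> V. f v = y}"
    by (auto simp: Suc_le_eq)
  then obtain S where "S \<subseteq> {v \<in> V. f v = y}" "card S = Suc k"
    by (meson obtain_subset_with_card_n)
  then show ?thesis
    using that[of S] by blast
qed

section \<open>Degrees in complementary host graphs\<close>

lemma simple_host_graph: "simple_graph (host_graph m c b)"
  by (auto simp: simple_graph_def host_graph_def complete_graph_def)

lemma verts_host_graph: "verts (host_graph m c b) = {..<m}"
  by (simp add: host_graph_def complete_graph_def)

lemma edges_host_graph_iff:
  "{u, v} \<in> edges (host_graph m c b) \<longleftrightarrow> u < m \<and> v < m \<and> u \<noteq> v \<and> c {u, v} = b"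
  by (auto simp: host_graph_def complete_graph_def nsets_def card_insert_if)

lemma degree_host_graph:
  assumes "v < m"
  shows "degree (host_graph m c b) v = card {u \<in> {..<m} - {v}. c {u, v} = b}"
proof -
  have "{e \<in> edges (host_graph m c b). v \<in> e}
      = (\<lambda>u. {u, v}) ` {u \<in> {..<m} - {v}. c {u, v} = b}" (is "?E = ?g ` ?N")
  proof
    show "?g ` ?N \<subseteq> ?E"
      using assms by (auto simp: edges_host_graph_iff)
    show "?E \<subseteq> ?g ` ?N"
    proof
      fix e assume e: "e \<in> ?E"
      then have "card e = 2"
        by (simp add: host_graph_def complete_graph_def nsets_def)
      then obtain u where "e = {u, v}"
        using e by (auto simp: card_2_iff)
      then show "e \<in> ?g ` ?N"
        using e by (auto simp: edges_host_graph_iff)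
    qed
  qed
  moreover have "inj_on ?g ?N"
    by (auto simp: inj_on_def doubleton_eq_iff)
  ultimately show ?thesis
    by (simp add: degree_def card_image)
qed

lemma degree_host_graph_add:
  assumes "v < m"
  shows "degree (host_graph m c b) v + degree (host_graph m c (\<not> b)) v = m - 1"
proof -
  have "degree (host_graph m c b) v + degree (host_graph m c (\<not> b)) v
      = card ({u \<in> {..<m} - {v}. c {u, v} = b} \<union> {u \<in> {..<m} - {v}. c {u, v} = (\<not> b)})"
    unfolding degree_host_graph[OF assms] by (rule card_Un_disjoint[symmetric]) auto
  also have "{u \<in> {..<m} - {v}. c {u, v} = b} \<union> {u \<in> {..<m} - {v}. c {u, v} = (\<not> b)}
      = {..<m} - {v}"
    by auto
  finally show ?thesis
    using assms by simp
qed

text \<open>Because the degrees in the two colors are complementary, singularity can be tested in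
  a single color.\<close>

lemma degree_host_graph_eq_iff:
  assumes "u < m" "v < m"
  shows "degree (host_graph m c b) u = degree (host_graph m c b) v
    \<longleftrightarrow> degree (host_graph m c True) u = degree (host_graph m c True) v"
  using degree_host_graph_add[OF assms(1), of c True] degree_host_graph_add[OF assms(2), of c True]
  by (cases b) auto

section \<open>Singular copies on ten or more vertices\<close>

lemma graph_iso_image:
  assumes "simple_graph G" "inj_on f (verts G)"
  shows "graph_iso G (f ` verts G, (`) f ` edges G)"
proof -
  have "{u, v} \<in> edges G \<longleftrightarrow> {f u, f v} \<in> (`) f ` edges G"
    if uv: "u \<in> verts G" "v \<in> verts G" for u v
  proof
    assume "{f u, f v} \<in> (`) f ` edges G"
    then obtain e where e: "e \<in> edges G" "f ` {u, v} = f ` e"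
      by auto
    moreover have "e \<subseteq> verts G"
      using e(1) assms(1) by (auto simp: simple_graph_def nsets_def)
    ultimately have "{u, v} = e"
      using assms(2) uv inj_on_image_eq_iff[of f "verts G" "{u, v}" e] by simp
    then show "{u, v} \<in> edges G"
      using e(1) by simp
  next
    assume "{u, v} \<in> edges G"
    then have "f ` {u, v} \<in> (`) f ` edges G"
      by (rule imageI)
    then show "{f u, f v} \<in> (`) f ` edges G"
      by simp
  qed
  moreover have "bij_betw f (verts G) (f ` verts G)"
    using assms(2) by (rule inj_on_imp_bij_betw)
  ultimately show ?thesis
    unfolding graph_iso_def fst_conv snd_conv by blast
qed

text \<open>Fix any one of the four vertices as the middle of the path: of its three edges to the other
  vertices, two share a color.\<close>

lemma monochromatic_path_in_four_set:
  fixes c :: "'a set \<Rightarrow> bool"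
  assumes "card S = 4"
  obtains p q r s where "S = {p, q, r, s}" "distinct [p, q, r, s]" "c {p, q} = c {q, r}"
proof -
  obtain q x y z where S: "S = {q, x, y, z}" "distinct [q, x, y, z]"
    using assms by (auto simp: card_Suc_eq numeral_eq_Suc)
  consider "c {q, x} = c {q, y}" | "c {q, x} = c {q, z}" | "c {q, y} = c {q, z}"
    by blast
  then show thesis
  proof cases
    case 1
    then show thesis
      using S by (intro that[of x q y z]) (auto simp: insert_commute)
  next
    case 2
    then show thesis
      using S by (intro that[of x q z y]) (auto simp: insert_commute)
  next
    case 3
    then show thesis
      using S by (intro that[of y q z x]) (auto simp: insert_commute)
  qed
qed

text \<open>This treats both graphs of the theorem at once, as both are spanning subgraphs
  of \<open>P\<^sub>3 \<union> K\<^sub>1\<close>.\<close>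

lemma singular_unavoidable_of_ten_le:
  fixes G :: "nat graph"
  assumes G: "verts G = {0, 1, 2, 3}" "edges G \<subseteq> {{0, 1}, {1, 2}}" and m: "10 \<le> m"
  shows "singular_unavoidable G m"
  unfolding singular_unavoidable_def
proof
  fix c :: "nat set \<Rightarrow> bool"
  obtain S where S: "S \<subseteq> {..<m}" "card S = Suc 3"
    and deg: "(\<forall>u\<in>S. \<forall>v\<in>S. degree (host_graph m c True) u = degree (host_graph m c True) v)
      \<or> inj_on (degree (host_graph m c True)) S"
    by (rule constant_or_injective_subset[of "{..<m}" 3 "degree (host_graph m c True)"])
      (use m in auto)
  obtain p q r s where pqrs: "S = {p, q, r, s}" "distinct [p, q, r, s]" "c {p, q} = c {q, r}"
    by (rule monochromatic_path_in_four_set[of S c]) (use S(2) in simp)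
  define f :: "nat \<Rightarrow> nat" where "f = (!) [p, q, r, s]"
  define H where "H = (f ` verts G, (`) f ` edges G)"
  define b where "b = c {p, q}"
  have simple: "simple_graph G"
    unfolding simple_graph_def using subset_trans[OF G(2)] by (simp add: G(1) nsets_def)
  have inj: "inj_on f (verts G)"
    using pqrs(2) by (auto simp: f_def G(1) inj_on_def)
  have verts: "verts H = S"
    by (simp add: H_def f_def G(1) pqrs(1))
  have edges: "edges H \<subseteq> {{p, q}, {q, r}}"
    using G(2) by (auto simp: H_def f_def)
  have "{{p, q}, {q, r}} \<subseteq> [S]\<^bsup>2\<^esup>"
    using pqrs(2) by (simp add: pqrs(1) nsets_def)
  with edges have "edges H \<subseteq> [S]\<^bsup>2\<^esup>"
    by (rule subset_trans)
  then have simple_H: "simple_graph H"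
    by (simp add: simple_graph_def verts) (simp add: pqrs(1))
  have "{{p, q}, {q, r}} \<subseteq> edges (host_graph m c b)"
    using pqrs S(1) by (simp add: b_def edges_host_graph_iff)
  with edges have "edges H \<subseteq> edges (host_graph m c b)"
    by (rule subset_trans)
  with simple_H have subgraph: "subgraph H (host_graph m c b)"
    using S(1) by (simp add: subgraph_def simple_host_graph verts verts_host_graph)
  have same_degree: "degree (host_graph m c b) u = degree (host_graph m c b) v
      \<longleftrightarrow> degree (host_graph m c True) u = degree (host_graph m c True) v"
    if "u \<in> S" "v \<in> S" for u v
    using that S(1) by (intro degree_host_graph_eq_iff) auto
  from deg have "(\<forall>u\<in>S. \<forall>v\<in>S. degree (host_graph m c b) u = degree (host_graph m c b) v)
      \<or> (\<forall>u\<in>S. \<forall>v\<in>S. u \<noteq> v \<longrightarrow> degree (host_graph m c b) u \<noteq> degree (host_graph m c b) v)"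
  proof
    assume "\<forall>u\<in>S. \<forall>v\<in>S. degree (host_graph m c True) u = degree (host_graph m c True) v"
    then show ?thesis
      using same_degree by blast
  next
    assume "inj_on (degree (host_graph m c True)) S"
    then show ?thesis
      using same_degree unfolding inj_on_def by blast
  qed
  with subgraph have "singular_subgraph H (host_graph m c b)"
    by (simp only: singular_subgraph_def verts simp_thms)
  then show "\<exists>b H. singular_subgraph H (host_graph m c b) \<and> graph_iso G H"
    using graph_iso_image[OF simple inj] unfolding H_def by blast
qed

section \<open>A coloring of nine vertices without singular copies\<close>

text \<open>The vertices below \<open>3\<close> form the triangle, those from \<open>3\<close> to \<open>5\<close> are joined only to the
  triangle, and those from \<open>6\<close> to \<open>8\<close> are isolated.\<close>

definition three_degrees_coloring :: "nat set \<Rightarrow> bool" where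
  "three_degrees_coloring e \<longleftrightarrow> e \<subseteq> {..<6} \<and> e \<inter> {..<3} \<noteq> {}"

lemma degree_three_degrees_coloring:
  assumes "v < 9"
  shows "degree (host_graph 9 three_degrees_coloring True) v
    = (if v < 3 then 5 else if v < 6 then 3 else 0)"
proof -
  have "{u \<in> {..<9} - {v}. three_degrees_coloring {u, v} = True}
      = (if v < 3 then {..<6} - {v} else if v < 6 then {..<3} else {})"
    using assms by (auto simp: three_degrees_coloring_def)
  then show ?thesis
    using assms by (simp add: degree_host_graph)
qed

text \<open>Four vertices neither fit into one of the three degree classes of size three nor have
  distinct degrees among three values.\<close>

lemma not_singular_unavoidable_nine:
  assumes card_G: "card (verts G) = 4"
  shows "\<not> singular_unavoidable G 9"
proof
  let ?d = "degree (host_graph 9 three_degrees_coloring True)"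
  assume "singular_unavoidable G 9"
  then obtain b H where H: "singular_subgraph H (host_graph 9 three_degrees_coloring b)"
    and iso: "graph_iso G H"
    unfolding singular_unavoidable_def by blast
  from iso obtain g where "bij_betw g (verts G) (verts H)"
    unfolding graph_iso_def by blast
  then have card_H: "card (verts H) = 4"
    using card_G bij_betw_same_card[of g "verts G" "verts H"] by simp
  have verts: "verts H \<subseteq> {..<9}"
    using H unfolding singular_subgraph_def subgraph_def verts_host_graph by blast
  have "degree (host_graph 9 three_degrees_coloring b) u
        = degree (host_graph 9 three_degrees_coloring b) v \<longleftrightarrow> ?d u = ?d v"
    if "u \<in> verts H" "v \<in> verts H" for u v
    using that verts by (intro degree_host_graph_eq_iff) auto
  then consider "\<forall>u\<in>verts H. \<forall>v\<in>verts H. ?d u = ?d v" | "inj_on ?d (verts H)"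
    using H unfolding singular_subgraph_def inj_on_def by metis
  then show False
  proof cases
    case 1
    obtain w where w: "w \<in> verts H"
      using card_H by (metis all_not_in_conv card.empty zero_neq_numeral)
    have block: "u < 9 \<and> (u < 3 \<longleftrightarrow> w < 3) \<and> (u < 6 \<longleftrightarrow> w < 6)" if "u \<in> verts H" for u
    proof -
      have "u < 9" "w < 9"
        using that w verts by auto
      moreover have "?d u = ?d w"
        using that w 1 by blast
      ultimately show ?thesis
        by (simp add: degree_three_degrees_coloring split: if_splits)
    qed
    have "verts H \<subseteq> {..<3} \<or> verts H \<subseteq> {3..<6} \<or> verts H \<subseteq> {6..<9}"
    proof (cases "w < 3")
      case True
      then show ?thesis
        using block by blast
    next
      case False
      then show ?thesis
        using block by (cases "w < 6") (simp_all add: subset_iff not_less)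
    qed
    then have "card (verts H) \<le> 3"
      using card_mono[of "{..<3}" "verts H"] card_mono[of "{3..<6}" "verts H"]
        card_mono[of "{6..<9}" "verts H"] by auto
    then show False
      using card_H by simp
  next
    case 2
    have "?d v \<in> {5, 3, 0}" if "v \<in> verts H" for v
    proof -
      have "v < 9"
        using that verts by auto
      then show ?thesis
        by (simp add: degree_three_degrees_coloring)
    qed
    then have "?d ` verts H \<subseteq> {5, 3, 0}"
      by (rule image_subsetI)
    then have "card (?d ` verts H) \<le> card {5, 3, 0 :: nat}"
      by (intro card_mono) auto
    then show False
      using card_H 2 by (simp add: card_image)
  qed
qed

section \<open>The singular Ramsey numbers\<close>

lemma Rs_eq_of_threshold:
  assumes "\<And>m. N \<le> m \<Longrightarrow> singular_unavoidable G m" "\<not> singular_unavoidable G k" "N = Suc k"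
  shows "Rs G = enat N"
  unfolding Rs_def
proof (rule antisym)
  show "Inf {enat N | N. \<forall>m\<ge>N. singular_unavoidable G m} \<le> enat N"
    using assms(1) by (intro Inf_lower) blast
  show "enat N \<le> Inf {enat N | N. \<forall>m\<ge>N. singular_unavoidable G m}"
    using assms(2,3) not_less_eq_eq by (intro Inf_greatest) auto
qed

theorem proposition33:
  shows "Rs P3_K1 = Rs K2_2K1 \<and> Rs K2_2K1 = 10"
proof -
  have "Rs G = 10" if "verts G = {0, 1, 2, 3}" "edges G \<subseteq> {{0, 1}, {1, 2}}" for G :: "nat graph"
  proof -
    have "Rs G = enat 10"
      using that
      by (intro Rs_eq_of_threshold[where k = 9] singular_unavoidable_of_ten_le
          not_singular_unavoidable_nine) simp_all
    then show ?thesis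
      by (simp add: numeral_eq_enat)
  qed
  then show ?thesis
    by (simp add: P3_K1_def K2_2K1_def)
qed

end
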